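(* Let $\mathcal{P}$ be a finite set of quasi-density properties and $\varphi$ a modal formula. If $\overline{\varphi}$ is $\mathcal{P}$-valid, then $\mathsf{contr}\in\mathcal{C}$ for every $\mathcal{C}\in\mathrm{Ch}(\mathcal{D}_\varphi,\mathcal{R}_\varphi\cup\mathcal{P})$.
   Context: Modal formulae are in negation normal form ($p,\neg p,\lor,\land,\Diamond,\Box$); $\overline\psi$ is the dual negation ($\overline p=\neg p$, $\overline{\neg p}=p$, swap $\lor/\land$ and $\Diamond/\Box$ recursively). A quasi-density property (QDP) is $\forall x,y\,(R^k(x,y)\to R^n(x,y))$ with $0<k<n$ ($R^\ell$ = existence of an $R$-path of length $\ell$); a $\mathcal P$-model is a Kripke model whose accessibility relation satisfies all QDPs in $\mathcal P$; $\psi$ is $\mathcal P$-valid if true at all worlds of all $\mathcal P$-models. Terms are words over disjoint countable sets of constants and variables; an instance is a (possibly infinite) set of atoms over terms. The signature has unary $P_\psi$ (for each subformula $\psi$ of $\varphi$), binary $R,E$ and nullary $\mathsf{contr}$. $\mathcal{D}_\varphi=\{P_\varphi(a)\}$ for a fixed constant $a$. Each QDP is the rule $R(x,y_1)\land\cdots\land R(y_{k-1},y)\to\exists z_1..z_{n-1}\,R(x,z_1)\land\cdots\land R(z_{n-1},y)$. $\mathcal R_\varphi$ consists of, for subformulae $\psi,\chi$ of $\varphi$: $P_{\psi\land\chi}(x)\to P_\psi(x)\land P_\chi(x)$; $P_{\psi\lor\chi}(x)\to P_\psi(x)\lor P_\chi(x)$; $P_{\Box\psi}(x)\land R(x,y)\to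 P_\psi(y)$; $P_{\Diamond\psi}(x)\to\exists y(R(x,y)\land E(x,y)\land P_\psi(y))$; $P_\psi(x)\land P_{\overline\psi}(x)\to\mathsf{contr}$. Disjunctive chase: a homomorphism maps terms to terms preserving atoms and fixing constants. A trigger in an instance $I$ is a pair $(\rho,h)$ with $h$ a homomorphism from the body of rule $\rho$ into $I$; it is active if there is no disjunct $\gamma$ of the head such that $h$ extends to a homomorphism of $\mathrm{body}(\rho)\land\gamma$ into $I$. Applying an active trigger yields the set of instances $I\cup\alpha(h(\vec y),\vec t)$, one for each disjunct $\exists\vec z\,\alpha(\vec y,\vec z)$ of the head, with $\vec t$ fresh terms. A fair derivation sequence of $I$ and a rule set $\mathcal R$ is a sequence $(I_i)$ with $I_0=I$, each $I_{i+1}$ in the application of some trigger in $I_i$, such that no trigger stays active indefinitely. $\mathrm{Ch}(I,\mathcal R)$ is the set of unions $\bigcup_i I_i$ over all fair derivation sequences. *)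

theory Defs
  imports Main "HOL-Library.Extended_Nat"
begin

datatype 'p fm =
    Lit 'p
  | NLit 'p
  | Disj "'p fm" "'p fm"
  | Conj "'p fm" "'p fm"
  | Dia "'p fm"
  | Box "'p fm"

primrec dual :: "'p fm \<Rightarrow> 'p fm" where
  "dual (Lit p) = NLit p"
| "dual (NLit p) = Lit p"
| "dual (Disj \<psi> \<chi>) = Conj (dual \<psi>) (dual \<chi>)"
| "dual (Conj \<psi> \<chi>) = Disj (dual \<psi>) (dual \<chi>)"
| "dual (Dia \<psi>) = Box (dual \<psi>)"
| "dual (Box \<psi>) = Dia (dual \<psi>)"

primrec subfms :: "'p fm \<Rightarrow> 'p fm set" where
  "subfms (Lit p) = {Lit p}"
| "subfms (NLit p) = {NLit p}"
| "subfms (Disj \<psi> \<chi>) = {Disj \<psi> \<chi>} \<union> subfms \<psi> \<union> subfms \<chi>"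
| "subfms (Conj \<psi> \<chi>) = {Conj \<psi> \<chi>} \<union> subfms \<psi> \<union> subfms \<chi>"
| "subfms (Dia \<psi>) = {Dia \<psi>} \<union> subfms \<psi>"
| "subfms (Box \<psi>) = {Box \<psi>} \<union> subfms \<psi>"

record ('w, 'p) kripke =
  worlds :: "'w set"
  acc :: "('w \<times> 'w) set"
  val :: "'p \<Rightarrow> 'w set"

definition kripke_model :: "('w, 'p) kripke \<Rightarrow> bool" where
  "kripke_model M \<longleftrightarrow>
     worlds M \<noteq> {} \<and> acc M \<subseteq> worlds M \<times> worlds M \<and> (\<forall>p. val M p \<subseteq> worlds M)"

primrec holds :: "('w, 'p) kripke \<Rightarrow> 'w \<Rightarrow> 'p fm \<Rightarrow> bool" where
  "holds M w (Lit p) \<longleftrightarrow> w \<in> val M p"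
| "holds M w (NLit p) \<longleftrightarrow> w \<notin> val M p"
| "holds M w (Disj \<psi> \<chi>) \<longleftrightarrow> holds M w \<psi> \<or> holds M w \<chi>"
| "holds M w (Conj \<psi> \<chi>) \<longleftrightarrow> holds M w \<psi> \<and> holds M w \<chi>"
| "holds M w (Dia \<psi>) \<longleftrightarrow> (\<exists>v. (w, v) \<in> acc M \<and> holds M v \<psi>)"
| "holds M w (Box \<psi>) \<longleftrightarrow> (\<forall>v. (w, v) \<in> acc M \<longrightarrow> holds M v \<psi>)"

text \<open>The pair \<open>(k, n)\<close> stands for the property \<open>\<forall>x y. R\<^sup>k(x,y) \<longrightarrow> R\<^sup>n(x,y)\<close>.\<close>

type_synonym qdp = "nat \<times> nat"

definition is_qdp :: "qdp \<Rightarrow> bool" where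
  "is_qdp = (\<lambda>(k, n). 0 < k \<and> k < n)"

definition satisfies_qdp :: "('w \<times> 'w) set \<Rightarrow> qdp \<Rightarrow> bool" where
  "satisfies_qdp r = (\<lambda>(k, n). \<forall>x y. (x, y) \<in> r ^^ k \<longrightarrow> (x, y) \<in> r ^^ n)"

definition qdp_model :: "qdp set \<Rightarrow> ('w, 'p) kripke \<Rightarrow> bool" where
  "qdp_model \<P> M \<longleftrightarrow> kripke_model M \<and> (\<forall>q\<in>\<P>. satisfies_qdp (acc M) q)"

text \<open>
  HOL cannot quantify over all types, so validity takes the type \<open>'w\<close> from which the worlds are
  drawn as an argument; the set of worlds is an arbitrary nonempty subset of that type.
\<close>

definition qdp_valid :: "'w itself \<Rightarrow> qdp set \<Rightarrow> 'p fm \<Rightarrow> bool" where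
  "qdp_valid (_ :: 'w itself) \<P> \<psi> \<longleftrightarrow>
     (\<forall>M :: ('w, 'p) kripke. qdp_model \<P> M \<longrightarrow> (\<forall>w\<in>worlds M. holds M w \<psi>))"

datatype symbol = Const nat | Var nat

type_synonym trm = "symbol list"

abbreviation const :: "nat \<Rightarrow> trm" where "const c \<equiv> [Const c]"

abbreviation var :: "nat \<Rightarrow> trm" where "var v \<equiv> [Var v]"

text \<open>\<open>Pr \<psi> t\<close> is the atom \<open>P\<^sub>\<psi>(t)\<close>.\<close>

datatype (dead 'p, terms_of_atom: 't) atom =
    Pr "'p fm" 't
  | R 't 't
  | E 't 't
  | Contr
  for map: map_atom

type_synonym 'p inst = "('p, trm) atom set"

definition terms_of :: "'p inst \<Rightarrow> trm set" where
  "terms_of I = (\<Union>A\<in>I. terms_of_atom A)"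

definition vars_of :: "'p inst \<Rightarrow> trm set" where
  "vars_of I = terms_of I \<inter> range var"

text \<open>
  The head is the set of its disjuncts. The existentially quantified variables of a disjunct are
  those of its variables that do not occur in the body.
\<close>

datatype 'p rule = Rule (body: "'p inst") (head: "'p inst set")

definition exvars :: "'p rule \<Rightarrow> 'p inst \<Rightarrow> trm set" where
  "exvars \<rho> \<gamma> = vars_of \<gamma> - vars_of (body \<rho>)"

definition fixes_consts :: "(trm \<Rightarrow> trm) \<Rightarrow> bool" where
  "fixes_consts h \<longleftrightarrow> (\<forall>c. h (const c) = const c)"

definition hom :: "(trm \<Rightarrow> trm) \<Rightarrow> 'p inst \<Rightarrow> 'p inst \<Rightarrow> bool" where
  "hom h A I \<longleftrightarrow> fixes_consts h \<and> map_atom h ` A \<subseteq> I"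

definition extends :: "(trm \<Rightarrow> trm) \<Rightarrow> (trm \<Rightarrow> trm) \<Rightarrow> 'p rule \<Rightarrow> bool" where
  "extends h' h \<rho> \<longleftrightarrow> (\<forall>t\<in>terms_of (body \<rho>). h' t = h t)"

text \<open>
  A homomorphism is represented by a total function; its values off the terms of the body are
  irrelevant for being a trigger, for activity and for the result of an application.
\<close>

type_synonym 'p trigger = "'p rule \<times> (trm \<Rightarrow> trm)"

definition is_trigger :: "'p rule set \<Rightarrow> 'p inst \<Rightarrow> 'p trigger \<Rightarrow> bool" where
  "is_trigger \<R> I = (\<lambda>(\<rho>, h). \<rho> \<in> \<R> \<and> hom h (body \<rho>) I)"

definition active :: "'p rule set \<Rightarrow> 'p inst \<Rightarrow> 'p trigger \<Rightarrow> bool" where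
  "active \<R> I = (\<lambda>(\<rho>, h). is_trigger \<R> I (\<rho>, h) \<and>
     \<not> (\<exists>\<gamma>\<in>head \<rho>. \<exists>h'. extends h' h \<rho> \<and> hom h' (body \<rho> \<union> \<gamma>) I))"

text \<open>
  All instances that result from an application, over all disjuncts and all choices of fresh
  terms for the existential variables.
\<close>

definition applications :: "'p inst \<Rightarrow> 'p trigger \<Rightarrow> 'p inst set" where
  "applications I = (\<lambda>(\<rho>, h). {I \<union> map_atom h' ` \<gamma> | \<gamma> h'.
     \<gamma> \<in> head \<rho> \<and> fixes_consts h' \<and> extends h' h \<rho> \<and>
     inj_on h' (exvars \<rho> \<gamma>) \<and> h' ` exvars \<rho> \<gamma> \<inter> terms_of I = {}})"

text \<open>
  A derivation sequence may be finite or infinite: \<open>N\<close> is its number of steps, so its members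
  are the \<open>S i\<close> with \<open>enat i \<le> N\<close>. In a finite fair sequence no trigger is active in the last
  instance.
\<close>

definition derivation :: "'p inst \<Rightarrow> 'p rule set \<Rightarrow> enat \<Rightarrow> (nat \<Rightarrow> 'p inst) \<Rightarrow> bool" where
  "derivation I \<R> N S \<longleftrightarrow> S 0 = I \<and>
     (\<forall>i. enat i < N \<longrightarrow> (\<exists>\<tau>. active \<R> (S i) \<tau> \<and> S (Suc i) \<in> applications (S i) \<tau>))"

definition fair :: "'p rule set \<Rightarrow> enat \<Rightarrow> (nat \<Rightarrow> 'p inst) \<Rightarrow> bool" where
  "fair \<R> N S \<longleftrightarrow> (\<forall>i \<tau>. enat i \<le> N \<longrightarrow> active \<R> (S i) \<tau> \<longrightarrow>
     (\<exists>j\<ge>i. enat j \<le> N \<and> \<not> active \<R> (S j) \<tau>))"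

definition Ch :: "'p inst \<Rightarrow> 'p rule set \<Rightarrow> 'p inst set" where
  "Ch I \<R> = {\<Union>i\<in>{i. enat i \<le> N}. S i | N S. derivation I \<R> N S \<and> fair \<R> N S}"

definition path_atoms :: "(nat \<Rightarrow> trm) \<Rightarrow> nat \<Rightarrow> 'p inst" where
  "path_atoms f m = {R (f i) (f (Suc i)) | i. i < m}"

text \<open>
  Here \<open>x\<close>, \<open>y\<^sub>i\<close>, \<open>y\<close> and \<open>z\<^sub>j\<close> are \<open>var 0\<close>, \<open>var i\<close>, \<open>var k\<close> and \<open>var (k + j)\<close>.
\<close>

definition qdp_rule :: "qdp \<Rightarrow> 'p rule" where
  "qdp_rule = (\<lambda>(k, n).
     Rule (path_atoms var k)
       {path_atoms (\<lambda>j. if j = 0 then var 0 else if j = n then var k else var (k + j)) n})"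

abbreviation vx :: trm where "vx \<equiv> var 0"

abbreviation vy :: trm where "vy \<equiv> var 1"

text \<open>The predicates \<open>P\<^sub>\<psi>\<close> of the rules range over the signature, i.e. \<open>\<psi> \<in> subfms \<phi>\<close>.\<close>

definition fm_rules :: "'p fm \<Rightarrow> 'p rule set" where
  "fm_rules \<phi> =
     {Rule {Pr (Conj \<psi> \<chi>) vx} {{Pr \<psi> vx, Pr \<chi> vx}} | \<psi> \<chi>. Conj \<psi> \<chi> \<in> subfms \<phi>}
   \<union> {Rule {Pr (Disj \<psi> \<chi>) vx} {{Pr \<psi> vx}, {Pr \<chi> vx}} | \<psi> \<chi>. Disj \<psi> \<chi> \<in> subfms \<phi>}
   \<union> {Rule {Pr (Box \<psi>) vx, R vx vy} {{Pr \<psi> vy}} | \<psi>. Box \<psi> \<in> subfms \<phi>}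
   \<union> {Rule {Pr (Dia \<psi>) vx} {{R vx vy, E vx vy, Pr \<psi> vy}} | \<psi>. Dia \<psi> \<in> subfms \<phi>}
   \<union> {Rule {Pr \<psi> vx, Pr (dual \<psi>) vx} {{Contr}} | \<psi>. \<psi> \<in> subfms \<phi> \<and> dual \<psi> \<in> subfms \<phi>}"

definition fm_db :: "nat \<Rightarrow> 'p fm \<Rightarrow> 'p inst" where
  "fm_db a \<phi> = {Pr \<phi> (const a)}"

end

theory Submission
  imports Defs
begin

text \<open>
  By fairness the union of a fair derivation sequence satisfies every rule. If it does not contain
  the contradiction atom, its terms and \<open>R\<close>-atoms therefore form a Kripke model satisfying the
  quasi-density properties, and every \<open>P\<^sub>\<psi>(t)\<close> in it makes \<open>\<psi>\<close> true at \<open>t\<close>. In particular \<open>\<phi>\<close>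
  holds at \<open>a\<close>, against the validity of its dual. As terms are countable, they can be named by the
  elements of any infinite type.
\<close>

section \<open>Limits of fair derivation sequences\<close>

definition closed_under :: "'p inst \<Rightarrow> 'p rule set \<Rightarrow> bool" where
  "closed_under C \<R> \<longleftrightarrow> (\<forall>\<rho>\<in>\<R>. \<forall>h. hom h (body \<rho>) C \<longrightarrow>
     (\<exists>\<gamma>\<in>head \<rho>. \<exists>h'. extends h' h \<rho> \<and> hom h' (body \<rho> \<union> \<gamma>) C))"

lemma derivation_mono:
  assumes d: "derivation I \<R> N S" and "i \<le> j" "enat j \<le> N"
  shows "S i \<subseteq> S j"
  using assms(2,3)
proof (induction j rule: dec_induct)
  case base
  then show ?case by simp
next
  case (step j)
  then have lt: "enat j < N"
    by (metis Suc_ile_eq)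
  with d obtain \<tau> where "S (Suc j) \<in> applications (S j) \<tau>"
    unfolding derivation_def by blast
  then have "S j \<subseteq> S (Suc j)"
    unfolding applications_def by (auto split: prod.splits)
  with step.IH lt show ?case by (meson order.trans less_imp_le)
qed

text \<open>The stages increase, so finitely many atoms, each present at some stage, are all present
  at the largest of these stages.\<close>

lemma finite_subset_derivation_union:
  assumes d: "derivation I \<R> N S" and "finite B"
    and "B \<subseteq> (\<Union>i\<in>{i. enat i \<le> N}. S i)"
  shows "\<exists>i. enat i \<le> N \<and> B \<subseteq> S i"
  using assms(2,3)
proof (induction B)
  case empty
  then show ?case by (metis empty_subsetI zero_enat_def zero_le)
next
  case (insert A B)
  then obtain i j where ij: "enat i \<le> N" "B \<subseteq> S i" "enat j \<le> N" "A \<in> S j"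
    by auto
  have "enat (max i j) \<le> N"
    using ij by (simp add: max_def)
  moreover have "insert A B \<subseteq> S (max i j)"
    using ij derivation_mono[OF d, of i "max i j"] derivation_mono[OF d, of j "max i j"]
      calculation by auto
  ultimately show ?case by blast
qed

text \<open>A body is finite, so a match in the union already exists at some stage \<open>i\<close>.
  Fairness gives a stage \<open>j\<close> from \<open>i\<close> on where the trigger is not active.
  The body is still matched there, so inactivity means that some disjunct is satisfied, and it stays
  satisfied in the larger set \<open>C\<close>.\<close>

lemma Ch_closed_under:
  assumes "C \<in> Ch I \<R>" and fin: "\<And>\<rho>. \<rho> \<in> \<R> \<Longrightarrow> finite (body \<rho>)"
  shows "closed_under C \<R>"
  unfolding closed_under_def
proof (intro ballI allI impI)
  fix \<rho> h
  assume \<rho>: "\<rho> \<in> \<R>" and h: "hom h (body \<rho>) C"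
  obtain N S where C: "C = (\<Union>i\<in>{i. enat i \<le> N}. S i)"
    and d: "derivation I \<R> N S" and f: "fair \<R> N S"
    using assms(1) unfolding Ch_def by blast
  have "finite (map_atom h ` body \<rho>)"
    using fin[OF \<rho>] by simp
  then obtain i where i: "enat i \<le> N" "map_atom h ` body \<rho> \<subseteq> S i"
    using finite_subset_derivation_union[OF d] h unfolding hom_def C by metis
  obtain j where j: "j \<ge> i" "enat j \<le> N" "\<not> active \<R> (S j) (\<rho>, h)"
    using f i(1) unfolding fair_def by (metis order_refl)
  have "map_atom h ` body \<rho> \<subseteq> S j"
    using derivation_mono[OF d j(1,2)] i(2) by blast
  then have "is_trigger \<R> (S j) (\<rho>, h)"
    using \<rho> h unfolding is_trigger_def hom_def by simp
  then obtain \<gamma> h' where "\<gamma> \<in> head \<rho>" "extends h' h \<rho>" "hom h' (body \<rho> \<union> \<gamma>) (S j)"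
    using j(3) unfolding active_def by auto
  moreover have "S j \<subseteq> C"
    using j(2) C by blast
  ultimately show "\<exists>\<gamma>\<in>head \<rho>. \<exists>h'. extends h' h \<rho> \<and> hom h' (body \<rho> \<union> \<gamma>) C"
    unfolding hom_def by (meson order.trans)
qed

lemma finite_body_rules:
  assumes "\<rho> \<in> fm_rules \<phi> \<union> qdp_rule ` \<P>"
  shows "finite (body \<rho>)"
proof -
  have "finite (path_atoms f k)" for f k
    unfolding path_atoms_def by simp
  then show ?thesis
    using assms unfolding fm_rules_def qdp_rule_def by (auto split: prod.splits)
qed

lemma Ch_contains_start: "C \<in> Ch I \<R> \<Longrightarrow> I \<subseteq> C"
  unfolding Ch_def derivation_def by (auto simp flip: zero_enat_def intro!: exI[of _ 0])

section \<open>Consequences of closure for the individual rules\<close>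

lemma closed_underD:
  assumes "closed_under C \<R>" "Rule B H \<in> \<R>" "fixes_consts h" "map_atom h ` B \<subseteq> C"
  shows "\<exists>\<gamma>\<in>H. \<exists>h'. (\<forall>t\<in>terms_of B. h' t = h t) \<and> map_atom h' ` \<gamma> \<subseteq> C"
proof -
  have "\<exists>\<gamma>\<in>H. \<exists>h'. extends h' h (Rule B H) \<and> hom h' (B \<union> \<gamma>) C"
    using assms unfolding closed_under_def hom_def by (metis rule.sel)
  then show ?thesis
    unfolding extends_def hom_def rule.sel image_Un by (meson le_sup_iff)
qed

lemma closed_under_fm_rules:
  assumes C: "closed_under C \<R>" and sub: "fm_rules \<phi> \<subseteq> \<R>"
  shows closed_Conj: "\<lbrakk>Pr (Conj \<psi> \<chi>) t \<in> C; Conj \<psi> \<chi> \<in> subfms \<phi>\<rbrakk> \<Longrightarrow> Pr \<psi> t \<in> C \<and> Pr \<chi> t \<in> C"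
    and closed_Disj: "\<lbrakk>Pr (Disj \<psi> \<chi>) t \<in> C; Disj \<psi> \<chi> \<in> subfms \<phi>\<rbrakk> \<Longrightarrow> Pr \<psi> t \<in> C \<or> Pr \<chi> t \<in> C"
    and closed_Box: "\<lbrakk>Pr (Box \<psi>) t \<in> C; R t u \<in> C; Box \<psi> \<in> subfms \<phi>\<rbrakk> \<Longrightarrow> Pr \<psi> u \<in> C"
    and closed_Dia: "\<lbrakk>Pr (Dia \<psi>) t \<in> C; Dia \<psi> \<in> subfms \<phi>\<rbrakk> \<Longrightarrow> \<exists>u. R t u \<in> C \<and> Pr \<psi> u \<in> C"
    and closed_Contr: "\<lbrakk>Pr \<psi> t \<in> C; Pr (dual \<psi>) t \<in> C; \<psi> \<in> subfms \<phi>; dual \<psi> \<in> subfms \<phi>\<rbrakk>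
      \<Longrightarrow> Contr \<in> C"
proof -
  \<comment> \<open>One substitution serves all five kinds of rule. If the body mentions only
    \<open>vx\<close>, then \<open>u\<close> is set to \<open>t\<close>: the value at
    \<open>vy\<close> is then arbitrary, and in the diamond rule the extension of \<open>h\<close>
    chooses its own.\<close>
  define h where "h = (\<lambda>t u s. if s = vx then t else if s = vy then u else s)" for t u :: trm
  have fix_h: "fixes_consts (h t u)" for t u
    unfolding h_def fixes_consts_def by simp
  \<comment> \<open>The third equation repeats the second because the simplifier turns
    \<open>1\<close> into \<open>Suc 0\<close>.\<close>
  have h_simps: "h t u vx = t" "h t u vy = u" "h t u (var (Suc 0)) = u" for t u
    unfolding h_def by simp_all
  note D = closed_underD[OF C _ fix_h]
  show "Pr \<psi> t \<in> C \<and> Pr \<chi> t \<in> C" if "Pr (Conj \<psi> \<chi>) t \<in> C" "Conj \<psi> \<chi> \<in> subfms \<phi>"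
  proof -
    have "Rule {Pr (Conj \<psi> \<chi>) vx} {{Pr \<psi> vx, Pr \<chi> vx}} \<in> \<R>"
      using that(2) by (intro subsetD[OF sub]) (simp add: fm_rules_def)
    from D[OF this, of t t] that(1) show ?thesis
      by (auto simp: h_simps terms_of_def)
  qed
  show "Pr \<psi> t \<in> C \<or> Pr \<chi> t \<in> C" if "Pr (Disj \<psi> \<chi>) t \<in> C" "Disj \<psi> \<chi> \<in> subfms \<phi>"
  proof -
    have "Rule {Pr (Disj \<psi> \<chi>) vx} {{Pr \<psi> vx}, {Pr \<chi> vx}} \<in> \<R>"
      using that(2) by (intro subsetD[OF sub]) (simp add: fm_rules_def)
    from D[OF this, of t t] that(1) show ?thesis
      by (auto simp: h_simps terms_of_def)
  qed
  show "Pr \<psi> u \<in> C" if "Pr (Box \<psi>) t \<in> C" "R t u \<in> C" "Box \<psi> \<in> subfms \<phi>"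
  proof -
    have "Rule {Pr (Box \<psi>) vx, R vx vy} {{Pr \<psi> vy}} \<in> \<R>"
      using that(3) by (intro subsetD[OF sub]) (simp add: fm_rules_def)
    from D[OF this, of t u] that(1,2) show ?thesis
      by (auto simp: h_simps terms_of_def)
  qed
  show "\<exists>u. R t u \<in> C \<and> Pr \<psi> u \<in> C" if "Pr (Dia \<psi>) t \<in> C" "Dia \<psi> \<in> subfms \<phi>"
  proof -
    have "Rule {Pr (Dia \<psi>) vx} {{R vx vy, E vx vy, Pr \<psi> vy}} \<in> \<R>"
      using that(2) by (intro subsetD[OF sub]) (simp add: fm_rules_def)
    from D[OF this, of t t] that(1) show ?thesis
      by (auto simp: h_simps terms_of_def)
  qed
  show "Contr \<in> C"
    if "Pr \<psi> t \<in> C" "Pr (dual \<psi>) t \<in> C" "\<psi> \<in> subfms \<phi>" "dual \<psi> \<in> subfms \<phi>"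
  proof -
    have "Rule {Pr \<psi> vx, Pr (dual \<psi>) vx} {{Contr}} \<in> \<R>"
      using that(3,4) by (intro subsetD[OF sub]) (auto simp: fm_rules_def)
    from D[OF this, of t t] that(1,2) show ?thesis
      by (auto simp: h_simps terms_of_def)
  qed
qed

text \<open>The path \<open>f\<close> is a match of the rule body; the extended homomorphism, read
  along the variables of the head, is the longer path.\<close>

lemma closed_qdp_rule:
  assumes C: "closed_under C \<R>" and q: "qdp_rule (k, n) \<in> \<R>" "0 < k" "k < n"
    and f: "\<forall>i<k. R (f i) (f (Suc i)) \<in> C"
  shows "\<exists>g. g 0 = f 0 \<and> g n = f k \<and> (\<forall>i<n. R (g i) (g (Suc i)) \<in> C)"
proof -
  \<comment> \<open>Injectivity of \<open>var\<close> makes \<open>THE\<close> return the index, and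
    constants lie outside \<open>range var\<close>, so they are fixed.\<close>
  define h where "h = (\<lambda>s. if s \<in> range var then f (THE i. s = var i) else s)"
  define z where "z = (\<lambda>j. if j = 0 then var 0 else if j = n then var k else var (k + j))"
  have fix_h: "fixes_consts h"
    unfolding h_def fixes_consts_def by auto
  have h_var: "h (var i) = f i" for i
    unfolding h_def by simp
  have rule: "Rule (path_atoms var k) {path_atoms z n} \<in> \<R>"
    using q(1) unfolding qdp_rule_def z_def by simp
  have "map_atom h ` path_atoms var k \<subseteq> C"
    using f by (auto simp: path_atoms_def h_var)
  from closed_underD[OF C rule fix_h this] obtain h' where
    h': "\<forall>t\<in>terms_of (path_atoms var k :: 'a inst). h' t = h t" "map_atom h' ` path_atoms z n \<subseteq> C"
    by auto
  \<comment> \<open>The extension \<open>h'\<close> is known only on terms of the body. The first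
    and last body atoms, which exist by \<open>0 < k\<close>, show that both ends of the head path
    are among these terms.\<close>
  have "R (var 0) (var (Suc 0)) \<in> (path_atoms var k :: 'a inst)"
    "R (var (k - 1)) (var k) \<in> (path_atoms var k :: 'a inst)"
    using q(2) unfolding path_atoms_def by force+
  then have "var 0 \<in> terms_of (path_atoms var k :: 'a inst)"
    "var k \<in> terms_of (path_atoms var k :: 'a inst)"
    unfolding terms_of_def by force+
  then have "h' (z 0) = f 0" "h' (z n) = f k"
    using h'(1) h_var q unfolding z_def by auto
  moreover have "\<forall>i<n. R (h' (z i)) (h' (z (Suc i))) \<in> C"
    using h'(2) unfolding path_atoms_def by force
  ultimately show ?thesis
    by (intro exI[of _ "h' \<circ> z"]) simp
qed

section \<open>The Kripke model read off from a closed instance\<close>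

text \<open>
  The condition \<open>Lit p \<in> subfms \<phi>\<close> is needed because the contradiction rule for \<open>p\<close> exists only if
  both \<open>p\<close> and its negation occur in \<open>\<phi>\<close>.
\<close>

definition inst_model :: "('w \<Rightarrow> trm) \<Rightarrow> 'p fm \<Rightarrow> 'p inst \<Rightarrow> ('w, 'p) kripke" where
  "inst_model g \<phi> C = \<lparr>worlds = UNIV, acc = {(u, v). R (g u) (g v) \<in> C},
     val = (\<lambda>p. {u. Lit p \<in> subfms \<phi> \<and> Pr (Lit p) (g u) \<in> C})\<rparr>"

text \<open>Paths between worlds map along \<open>g\<close> to paths between terms, are replaced
  there by longer ones, and are lifted back by surjectivity.\<close>

lemma qdp_model_inst_model:
  assumes C: "closed_under C \<R>" and sub: "qdp_rule ` \<P> \<subseteq> \<R>" and qdp: "\<forall>q\<in>\<P>. is_qdp q"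
    and "surj g"
  shows "qdp_model \<P> (inst_model g \<phi> C)"
proof -
  have "(x, y) \<in> acc (inst_model g \<phi> C) ^^ n"
    if kn: "(k, n) \<in> \<P>" and xy: "(x, y) \<in> acc (inst_model g \<phi> C) ^^ k" for k n x y
  proof -
    obtain f where f: "f 0 = x" "f k = y" "\<forall>i<k. R (g (f i)) (g (f (Suc i))) \<in> C"
      using xy unfolding relpow_fun_conv inst_model_def by auto
    have lt: "0 < k" "k < n"
      using qdp kn unfolding is_qdp_def by auto
    have "qdp_rule (k, n) \<in> \<R>"
      using kn sub by blast
    from closed_qdp_rule[OF C this lt, of "g \<circ> f"] f obtain z where
      z: "z 0 = g x" "z n = g y" "\<forall>i<n. R (z i) (z (Suc i)) \<in> C"
      by auto
    \<comment> \<open>Since \<open>g\<close> need not be injective, \<open>inv g (g x)\<close> may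
      differ from \<open>x\<close>. The two ends are therefore prescribed, and only inner points are
      lifted by \<open>inv g\<close>.\<close>
    define w where "w = (\<lambda>i. if i = 0 then x else if i = n then y else inv g (z i))"
    have "g (w i) = z i" for i
      using z(1,2) \<open>surj g\<close> unfolding w_def by (simp add: surj_f_inv_f)
    then show ?thesis
      using z(3) lt unfolding relpow_fun_conv inst_model_def
      by (intro exI[of _ w] conjI) (simp add: w_def, simp add: w_def, simp)
  qed
  then show ?thesis
    unfolding qdp_model_def satisfies_qdp_def kripke_model_def
    by (auto simp: inst_model_def)
qed

lemma subfms_refl: "\<psi> \<in> subfms \<psi>"
  by (cases \<psi>) auto

lemma subfms_trans: "\<psi> \<in> subfms \<chi> \<Longrightarrow> \<chi> \<in> subfms \<phi> \<Longrightarrow> \<psi> \<in> subfms \<phi>"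
  by (induction \<phi>) auto

text \<open>One half of a truth lemma: \<open>C\<close> need not decide every subformula, so the
  converse is not claimed. Immediate subformulas stay in \<open>subfms \<phi>\<close>, which keeps
  the induction hypotheses applicable.\<close>

lemma holds_inst_model:
  assumes C: "closed_under C \<R>" "fm_rules \<phi> \<subseteq> \<R>" and "surj g" and nc: "Contr \<notin> C"
  shows "\<psi> \<in> subfms \<phi> \<Longrightarrow> Pr \<psi> (g w) \<in> C \<Longrightarrow> holds (inst_model g \<phi> C) w \<psi>"
proof (induction \<psi> arbitrary: w)
  case (Lit p)
  then show ?case by (simp add: inst_model_def)
next
  case (NLit p)
  \<comment> \<open>If \<open>p\<close> were true at \<open>w\<close>, the definition of
    \<open>val\<close> would put \<open>Lit p\<close> in \<open>subfms \<phi>\<close> and its atom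
    in \<open>C\<close>, and the contradiction rule for \<open>NLit p\<close> would fire.\<close>
  then show ?case
    using closed_Contr[OF C, of "NLit p"] nc by (auto simp: inst_model_def)
next
  case (Disj \<psi> \<chi>)
  moreover have "\<psi> \<in> subfms \<phi>" "\<chi> \<in> subfms \<phi>"
    using subfms_trans[OF _ Disj.prems(1)] subfms_refl by auto
  ultimately show ?case using closed_Disj[OF C, of \<psi> \<chi> "g w"] by auto
next
  case (Conj \<psi> \<chi>)
  moreover have "\<psi> \<in> subfms \<phi>" "\<chi> \<in> subfms \<phi>"
    using subfms_trans[OF _ Conj.prems(1)] subfms_refl by auto
  ultimately show ?case using closed_Conj[OF C, of \<psi> \<chi> "g w"] by auto
next
  case (Dia \<psi>)
  have "\<psi> \<in> subfms \<phi>"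
    using subfms_trans[OF _ Dia.prems(1)] subfms_refl by auto
  moreover obtain u where "R (g w) u \<in> C" "Pr \<psi> u \<in> C"
    using closed_Dia[OF C] Dia.prems by blast
  moreover obtain v where "u = g v"
    using \<open>surj g\<close> by blast
  ultimately show ?case
    using Dia.IH by (auto simp: inst_model_def)
next
  case (Box \<psi>)
  moreover have "\<psi> \<in> subfms \<phi>"
    using subfms_trans[OF _ Box.prems(1)] subfms_refl by auto
  ultimately show ?case
    using closed_Box[OF C, of \<psi> "g w"] by (auto simp: inst_model_def)
qed

lemma holds_dual: "holds M w (dual \<psi>) \<longleftrightarrow> \<not> holds M w \<psi>"
  by (induction \<psi> arbitrary: w) auto

section \<open>Naming terms by worlds, and the final contradiction\<close>

instance symbol :: countable
  by countable_datatype

text \<open>Terms are lists over a countable type, hence embed into \<open>nat\<close> and so into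
  any infinite type; an inverse of the embedding is onto.\<close>

lemma ex_surj_onto_terms:
  assumes "infinite (UNIV :: 'w set)"
  shows "\<exists>g :: 'w \<Rightarrow> trm. surj g"
proof -
  obtain f :: "nat \<Rightarrow> 'w" where "inj f"
    using infinite_countable_subset[OF assms] by blast
  then have "inj (f \<circ> (to_nat :: trm \<Rightarrow> nat))"
    by (simp add: inj_compose)
  then show ?thesis
    using inj_imp_surj_inv by blast
qed

theorem theorem3p5:
  fixes \<P> :: "qdp set" and \<phi> :: "'p fm" and a :: nat
  assumes "finite \<P>"
    and "\<forall>q\<in>\<P>. is_qdp q"
    and "infinite (UNIV :: 'w set)"
    and "qdp_valid TYPE('w) \<P> (dual \<phi>)"
  shows "\<forall>C \<in> Ch (fm_db a \<phi>) (fm_rules \<phi> \<union> qdp_rule ` \<P>). Contr \<in> C"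
proof (intro ballI, rule ccontr)
  fix C
  assume C: "C \<in> Ch (fm_db a \<phi>) (fm_rules \<phi> \<union> qdp_rule ` \<P>)" and nc: "Contr \<notin> C"
  obtain g :: "'w \<Rightarrow> trm" where g: "surj g"
    using ex_surj_onto_terms[OF assms(3)] by blast
  then obtain w where w: "g w = const a"
    by (metis surjD)
  have closed: "closed_under C (fm_rules \<phi> \<union> qdp_rule ` \<P>)"
    using C finite_body_rules by (rule Ch_closed_under)
  have "Pr \<phi> (g w) \<in> C"
    using Ch_contains_start[OF C] w unfolding fm_db_def by simp
  then have "holds (inst_model g \<phi> C) w \<phi>"
    using holds_inst_model[OF closed _ g nc] subfms_refl by blast
  moreover have "qdp_model \<P> (inst_model g \<phi> C)"
    using qdp_model_inst_model[OF closed _ assms(2) g] by blast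
  \<comment> \<open>Every element of the type is a world, so validity of the dual applies at
    \<open>w\<close> and refutes \<phi> there.\<close>
  ultimately show False
    using assms(4) unfolding qdp_valid_def holds_dual by (auto simp: inst_model_def)
qed

end
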